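(* Let $p\ge 3$ be a prime and let $G$ be a finite $p$-group of nilpotency class $2$ with cyclic center. Then there exists an abelian normal subgroup $H$ of maximum order in $G$ such that $\exp(H)=|Z(G)|$.
   Context: $\exp(H)$ is the exponent of $H$ and $Z(G)$ is the center of $G$. *)

theory Defs
  imports "HOL-Algebra.Elementary_Groups" "HOL-Computational_Algebra.Primes"
begin

definition center :: "('a, 'b) monoid_scheme \<Rightarrow> 'a set"
  where "center G = {z \<in> carrier G. \<forall>x \<in> carrier G. z \<otimes>\<^bsub>G\<^esub> x = x \<otimes>\<^bsub>G\<^esub> z}"

definition commutator_subgroup :: "('a, 'b) monoid_scheme \<Rightarrow> 'a set \<Rightarrow> 'a set \<Rightarrow> 'a set"
  where "commutator_subgroup G H K =
    generate G {h \<otimes>\<^bsub>G\<^esub> k \<otimes>\<^bsub>G\<^esub> inv\<^bsub>G\<^esub> h \<otimes>\<^bsub>G\<^esub> inv\<^bsub>G\<^esub> k | h k. h \<in> H \<and> k \<in> K}"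

(* Indexed from 0, so lower_central_series G n is the term usually called gamma_(n+1). *)
primrec lower_central_series :: "('a, 'b) monoid_scheme \<Rightarrow> nat \<Rightarrow> 'a set"
  where
    "lower_central_series G 0 = carrier G"
  | "lower_central_series G (Suc n) = commutator_subgroup G (lower_central_series G n) (carrier G)"

(* The class is exactly c: the series reaches the trivial subgroup at index c and not earlier. *)
definition has_nilpotency_class :: "('a, 'b) monoid_scheme \<Rightarrow> nat \<Rightarrow> bool"
  where "has_nilpotency_class G c \<longleftrightarrow>
    lower_central_series G c = {\<one>\<^bsub>G\<^esub>} \<and>
    (\<forall>k < c. lower_central_series G k \<noteq> {\<one>\<^bsub>G\<^esub>})"

(* Finiteness is part of this notion: the order of an infinite group is 0, which is not p ^ n
   when p is prime. *)
definition finite_p_group :: "nat \<Rightarrow> ('a, 'b) monoid_scheme \<Rightarrow> bool"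
  where "finite_p_group p G \<longleftrightarrow> group G \<and> prime p \<and> (\<exists>n. order G = p ^ n)"

(* Meaningful for groups of finite exponent, in particular for all finite groups. *)
definition exponent :: "('a, 'b) monoid_scheme \<Rightarrow> nat"
  where "exponent G = (LEAST n. 0 < n \<and> (\<forall>x \<in> carrier G. x [^]\<^bsub>G\<^esub> n = \<one>\<^bsub>G\<^esub>))"

definition abelian_normal_subgroup :: "'a set \<Rightarrow> ('a, 'b) monoid_scheme \<Rightarrow> bool"
  where "abelian_normal_subgroup H G \<longleftrightarrow> H \<lhd> G \<and> comm_group (G\<lparr>carrier := H\<rparr>)"

end

theory Submission
  imports Defs "HOL-Algebra.Multiplicative_Group"
begin

text \<open>
  Write \<open>Z\<close> for the center and \<open>C(B)\<close> for the centralizer of \<open>B\<close>. As commutators are central, the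
  commutator induces an alternating bilinear map from \<open>G/Z\<close> to \<open>Z\<close>, and this pairing is nondegenerate.
  Because \<open>Z\<close> is cyclic, it behaves like a symplectic form: \<open>|C(B)| |B| = |G| |Z|\<close> for
  every subgroup \<open>B\<close> that contains \<open>Z\<close> (lemma \<open>card_centralizer\<close>). Hence an abelian subgroup \<open>A\<close> has
  \<open>|A|\<^sup>2 \<le> |G| |Z|\<close> (lemma \<open>card_abelian_square_le\<close>), with equality for a self-centralizing one. Every
  subgroup that contains \<open>Z\<close> is normal, so the task is to find a self-centralizing \<open>H\<close> whose exponent is
  \<open>n = |Z|\<close>. The exponent is at least \<open>n\<close>, since \<open>H\<close> contains a generator of \<open>Z\<close>.

  As \<open>p\<close> is odd, so is \<open>n\<close>, and therefore \<open>x \<mapsto> x\<^sup>n\<close> is a homomorphism from \<open>G\<close> to \<open>Z\<close>: the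
  correction factor in \<open>(x y)\<^sup>n\<close> is a commutator raised to \<open>n (n - 1) / 2\<close>, a multiple of \<open>n\<close>. Let \<open>K\<close>
  be the kernel of this map, and let \<open>H\<close> be maximal among the abelian subgroups between \<open>Z\<close> and \<open>K\<close>. Then
  \<open>C(H) \<inter> K = H\<close>, so \<open>C(H)/H\<close> embeds into the cyclic group \<open>Z\<close>. Thus \<open>C(H)\<close> is generated by \<open>H\<close>, which is
  central in it, and one further element, and is abelian.
  Now \<open>|C(H)|\<^sup>2 \<le> |G| |Z| = |C(H)| |H|\<close> forces \<open>C(H) = H\<close>
  (theorem \<open>ex_self_centralizing_subgroup\<close>).
\<close>

section \<open>Centralizers\<close>

definition centralizer :: "('a, 'b) monoid_scheme \<Rightarrow> 'a set \<Rightarrow> 'a set"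
  where "centralizer G S = {x \<in> carrier G. \<forall>s \<in> S. x \<otimes>\<^bsub>G\<^esub> s = s \<otimes>\<^bsub>G\<^esub> x}"

lemma center_eq_centralizer: "center G = centralizer G (carrier G)"
  by (simp add: center_def centralizer_def)

context group
begin

lemma subgroup_centralizer:
  assumes "S \<subseteq> carrier G"
  shows "subgroup (centralizer G S) G"
proof (rule subgroupI)
  show "centralizer G S \<subseteq> carrier G" by (auto simp: centralizer_def)
  have "\<one> \<in> centralizer G S" using assms by (auto simp: centralizer_def)
  then show "centralizer G S \<noteq> {}" by blast
next
  fix a assume a: "a \<in> centralizer G S"
  then have aG: "a \<in> carrier G" by (simp add: centralizer_def)
  have "inv a \<otimes> s = s \<otimes> inv a" if "s \<in> S" for s
  proof -
    have sG: "s \<in> carrier G" using that assms by blast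
    have "a \<otimes> s = s \<otimes> a" using a that by (simp add: centralizer_def)
    then have "s = inv a \<otimes> (s \<otimes> a)" using aG sG inv_solve_left by simp
    then show ?thesis using aG sG by (simp add: inv_solve_right m_assoc)
  qed
  then show "inv a \<in> centralizer G S" using aG by (simp add: centralizer_def)
next
  fix a b assume ab: "a \<in> centralizer G S" "b \<in> centralizer G S"
  then have G: "a \<in> carrier G" "b \<in> carrier G" by (simp_all add: centralizer_def)
  have "a \<otimes> b \<otimes> s = s \<otimes> (a \<otimes> b)" if "s \<in> S" for s
  proof -
    have sG: "s \<in> carrier G" using that assms by blast
    have "a \<otimes> s = s \<otimes> a" "b \<otimes> s = s \<otimes> b" using ab that by (simp_all add: centralizer_def)
    then show ?thesis using G sG by (metis m_assoc)
  qed
  then show "a \<otimes> b \<in> centralizer G S" using G by (simp add: centralizer_def)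
qed

lemma subgroup_center: "subgroup (center G) G"
  by (simp add: center_eq_centralizer subgroup_centralizer)

lemma centralizer_subset: "centralizer G S \<subseteq> carrier G"
  by (auto simp: centralizer_def)

lemma centralizer_antimono: "S \<subseteq> T \<Longrightarrow> centralizer G T \<subseteq> centralizer G S"
  by (auto simp: centralizer_def)

lemma centralizer_generate:
  assumes "S \<subseteq> carrier G"
  shows "centralizer G (generate G S) = centralizer G S"
proof
  show "centralizer G (generate G S) \<subseteq> centralizer G S"
    by (rule centralizer_antimono) (auto intro: generate.incl)
  show "centralizer G S \<subseteq> centralizer G (generate G S)"
  proof
    fix u assume u: "u \<in> centralizer G S"
    then have uG: "u \<in> carrier G" by (simp add: centralizer_def)
    have "S \<subseteq> centralizer G {u}" using u assms by (auto simp: centralizer_def)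
    then have "generate G S \<subseteq> centralizer G {u}"
      using generate_subgroup_incl subgroup_centralizer uG by simp
    then show "u \<in> centralizer G (generate G S)" using uG by (auto simp: centralizer_def)
  qed
qed

lemma commuting_generators:
  assumes "S \<subseteq> centralizer G S"
  shows "generate G S \<subseteq> centralizer G (generate G S)"
proof -
  have "S \<subseteq> carrier G" using assms centralizer_subset by blast
  then show ?thesis
    using assms centralizer_generate generate_subgroup_incl subgroup_centralizer by simp
qed

lemma center_subset_centralizer: "S \<subseteq> carrier G \<Longrightarrow> center G \<subseteq> centralizer G S"
  by (simp add: center_eq_centralizer centralizer_antimono)

text \<open>A conjugate of \<open>h\<close> differs from \<open>h\<close> by a commutator, which is central.\<close>
lemma normal_of_center_subset:
  assumes comm: "\<And>x y. \<lbrakk>x \<in> carrier G; y \<in> carrier G\<rbrakk> \<Longrightarrow> x \<otimes> y \<otimes> inv x \<otimes> inv y \<in> center G"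
    and H: "subgroup H G" "center G \<subseteq> H"
  shows "H \<lhd> G"
  unfolding normal_inv_iff
proof (intro conjI ballI H(1))
  fix x h assume x: "x \<in> carrier G" and h: "h \<in> H"
  have hG: "h \<in> carrier G" by (rule subgroup.mem_carrier[OF H(1) h])
  have "x \<otimes> h \<otimes> inv x \<otimes> inv h \<in> H" using comm[OF x hG] H(2) by blast
  then have "x \<otimes> h \<otimes> inv x \<otimes> inv h \<otimes> h \<in> H" using h H(1) by (simp add: subgroup.m_closed)
  then show "x \<otimes> h \<otimes> inv x \<in> H" using x hG by (simp add: m_assoc)
qed

end

section \<open>Cyclic groups and powers\<close>

context group
begin

text \<open>
  The number \<open>d\<close> is the order of \<open>x\<close> modulo \<open>B\<close>. Working with the least exponent makes it available for
  subgroups \<open>B\<close> that are not normal.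
\<close>
lemma least_power_in_subgroup:
  assumes fin: "finite (carrier G)" and x: "x \<in> carrier G" and B: "subgroup B G"
  obtains d :: nat where "0 < d" "x [^] d \<in> B" "\<And>k. \<lbrakk>k < d; x [^] k \<in> B\<rbrakk> \<Longrightarrow> k = 0"
proof -
  let ?P = "\<lambda>d::nat. 0 < d \<and> x [^] d \<in> B"
  have "?P (ord x)"
    using ord_ge_1[OF fin x] x B by (simp add: subgroup.one_closed)
  then have "?P (LEAST d. ?P d)" by (rule LeastI)
  moreover have "k = 0" if "k < (LEAST d. ?P d)" "x [^] k \<in> B" for k
    using not_less_Least[OF that(1)] that(2) by simp
  ultimately show thesis using that by blast
qed

text \<open>
  Division with remainder: if \<open>z\<^sup>d\<close> is the least positive power of \<open>z\<close> in \<open>T\<close>, then the exponent of any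
  power in \<open>T\<close> leaves remainder \<open>0\<close> modulo \<open>d\<close>.
\<close>
lemma subgroup_of_cyclic:
  assumes fin: "finite (carrier G)" and z: "z \<in> carrier G"
    and T: "subgroup T G" "T \<subseteq> generate G {z}"
  obtains t where "t \<in> T" "T = generate G {t}"
proof -
  obtain d :: nat where d: "0 < d" "z [^] d \<in> T"
    and min: "\<And>k. \<lbrakk>k < d; z [^] k \<in> T\<rbrakk> \<Longrightarrow> k = 0"
    using least_power_in_subgroup[OF fin z T(1)] by blast
  have "t \<in> generate G {z [^] d}" if t: "t \<in> T" for t
  proof -
    obtain k :: int where k: "t = z [^] k" using t T(2) generate_pow[OF z] by auto
    define q where "q = k div int d"
    have pow: "(z [^] d) [^] j = z [^] (int d * j)" for j :: int
      using int_pow_pow[OF z, of "int d" j] by (simp add: int_pow_int)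
    have "k mod int d = k + int d * (-q)" by (simp add: q_def minus_mult_div_eq_mod)
    then have "z [^] (k mod int d) = t \<otimes> (z [^] d) [^] (-q)"
      unfolding pow k by (simp only: int_pow_mult[OF z])
    moreover have "\<dots> \<in> T"
      using t d(2) T(1) by (simp add: subgroup.m_closed subgroup_int_pow_closed)
    ultimately have "z [^] nat (k mod int d) \<in> T"
      using d(1) by (simp flip: int_pow_int)
    then have "nat (k mod int d) = 0" by (rule min[rotated]) (use d(1) in \<open>simp add: nat_less_iff\<close>)
    then have "k mod int d = 0"
      using d(1) pos_mod_sign[of "int d" k] by linarith
    then have "k = int d * q" using mult_div_mod_eq[of "int d" k] by (simp add: q_def)
    then have "t = (z [^] d) [^] q" by (simp only: pow k)
    then show ?thesis using z generate_pow[of "z [^] d"] by auto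
  qed
  moreover have "generate G {z [^] d} \<subseteq> T" using d(2) T(1) by (simp add: generate_subgroup_incl)
  ultimately show thesis using d(2) that by blast
qed

text \<open>
  The \<open>r\<close>-torsion is itself cyclic, and its order is the order of a generator, which divides \<open>r\<close>. This
  bound is where cyclicity of the center enters the counting of centralizers.
\<close>
lemma card_torsion_of_cyclic_le:
  assumes fin: "finite (carrier G)" and z: "z \<in> carrier G" and r: "0 < (r::nat)"
  shows "card {c \<in> generate G {z}. c [^] r = \<one>} \<le> r"
proof -
  let ?T = "{c \<in> generate G {z}. c [^] r = \<one>}"
  have "subgroup ?T G"
  proof (rule subgroupI)
    have Z: "subgroup (generate G {z}) G" using z by (simp add: generate_is_subgroup)
    show "?T \<subseteq> carrier G" using Z subgroup.subset by blast
    have "\<one> \<in> ?T" by (simp add: generate.one)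
    then show "?T \<noteq> {}" by blast
    show "inv a \<in> ?T" if "a \<in> ?T" for a
      using that Z by (auto simp: subgroup.m_inv_closed nat_pow_inv subgroup.mem_carrier)
    show "a \<otimes> b \<in> ?T" if "a \<in> ?T" "b \<in> ?T" for a b
    proof -
      have ab: "a \<in> carrier G" "b \<in> carrier G" using that subgroup.mem_carrier[OF Z] by simp_all
      have "a \<in> generate G {z}" "b \<in> generate G {z}" using that by simp_all
      then obtain i j :: int where "a = z [^] i" "b = z [^] j"
        unfolding generate_pow[OF z] by blast
      then have "a \<otimes> b = b \<otimes> a" using int_pow_mult[OF z] by (metis add.commute)
      then have "(a \<otimes> b) [^] r = \<one>" using that ab by (simp add: pow_mult_distrib)
      then show ?thesis using that Z by (simp add: subgroup.m_closed)
    qed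
  qed
  then obtain t where t: "t \<in> ?T" "?T = generate G {t}"
    by (rule subgroup_of_cyclic[OF fin z]) auto
  have tG: "t \<in> carrier G" using t(1) z generate_in_carrier[of "{z}" t] by simp
  have "card ?T = ord t" using generate_pow_card[OF tG] t(2) by simp
  also have "\<dots> \<le> r" using t(1) tG r by (simp add: pow_eq_id dvd_imp_le)
  finally show ?thesis .
qed

lemma commutator_swap:
  assumes "x \<in> carrier G" "y \<in> carrier G"
  shows "x \<otimes> y = (x \<otimes> y \<otimes> inv x \<otimes> inv y) \<otimes> (y \<otimes> x)"
proof -
  have "(x \<otimes> y \<otimes> inv x \<otimes> inv y) \<otimes> (y \<otimes> x) = x \<otimes> y \<otimes> inv x \<otimes> (inv y \<otimes> y) \<otimes> x"
    using assms by (simp only: m_assoc m_closed inv_closed)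
  also have "\<dots> = x \<otimes> y \<otimes> (inv x \<otimes> x)" using assms by (simp add: m_assoc)
  also have "\<dots> = x \<otimes> y" using assms by simp
  finally show ?thesis ..
qed

text \<open>
  The next two lemmas are power laws for a central \<open>c = [y, x]\<close>. Moving \<open>x\<close> past \<open>y\<^sup>k\<close> produces
  \<open>c\<^sup>k\<close>, and collecting the powers of \<open>x\<close> in \<open>(x y)\<^sup>k\<close> then accumulates the exponents \<open>0, ..., k - 1\<close> of \<open>c\<close>.
\<close>
lemma pow_commute_central:
  assumes c: "c \<in> center G" and x: "x \<in> carrier G" and y: "y \<in> carrier G"
    and yx: "y \<otimes> x = c \<otimes> (x \<otimes> y)"
  shows "y [^] k \<otimes> x = c [^] (k::nat) \<otimes> (x \<otimes> y [^] k)"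
proof (induction k)
  case 0
  then show ?case using x by simp
next
  case (Suc k)
  have cG: "c \<in> carrier G" using c by (simp add: center_def)
  have cc: "c \<otimes> u = u \<otimes> c" if "u \<in> carrier G" for u using c that by (simp add: center_def)
  have "y [^] Suc k \<otimes> x = y [^] k \<otimes> (c \<otimes> (x \<otimes> y))" using x y yx by (simp add: m_assoc)
  also have "\<dots> = c \<otimes> (y [^] k \<otimes> x) \<otimes> y"
    using x y cG cc[of "y [^] k"] by (simp add: m_assoc[symmetric])
  also have "\<dots> = c \<otimes> (c [^] k \<otimes> (x \<otimes> y [^] k)) \<otimes> y" by (simp add: Suc.IH)
  also have "\<dots> = c [^] Suc k \<otimes> (x \<otimes> y [^] Suc k)"
    using x y cG cc[of "c [^] k"] by (simp add: m_assoc[symmetric])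
  finally show ?case .
qed

lemma mult_pow_central:
  assumes c: "c \<in> center G" and x: "x \<in> carrier G" and y: "y \<in> carrier G"
    and yx: "y \<otimes> x = c \<otimes> (x \<otimes> y)"
  shows "(x \<otimes> y) [^] k = c [^] (k choose 2) \<otimes> (x [^] k \<otimes> y [^] (k::nat))"
proof (induction k)
  case 0
  then show ?case by (simp add: binomial_eq_0)
next
  case (Suc k)
  have cG: "c \<in> carrier G" using c by (simp add: center_def)
  have cen: "c [^] m \<otimes> u = u \<otimes> c [^] m" if "u \<in> carrier G" for u and m :: nat
    using c that cG by (simp add: center_def pow_mult_distrib) (metis nat_pow_comm group_commutes_pow)
  have "(x \<otimes> y) [^] Suc k = c [^] (k choose 2) \<otimes> (x [^] k \<otimes> (y [^] k \<otimes> x) \<otimes> y)"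
    using x y cG by (simp add: Suc.IH m_assoc)
  also have "\<dots> = c [^] (k choose 2) \<otimes> (x [^] k \<otimes> (c [^] k \<otimes> (x \<otimes> y [^] k)) \<otimes> y)"
    by (simp add: pow_commute_central[OF assms])
  also have "\<dots> = c [^] (k choose 2) \<otimes> c [^] k \<otimes> (x [^] Suc k \<otimes> y [^] Suc k)"
    using x y cG cen[of "x [^] k" k, symmetric] by (simp add: m_assoc) (simp add: m_assoc[symmetric])
  also have "c [^] (k choose 2) \<otimes> c [^] k = c [^] (Suc k choose 2)"
    using cG by (simp add: nat_pow_mult numeral_2_eq_2 add.commute)
  finally show ?case .
qed

end

section \<open>Groups of class two with cyclic center\<close>

locale class2_cyclic_center = group +
  fixes z
  assumes finite_carrier: "finite (carrier G)"
    and commutator_central: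
      "\<And>x y. \<lbrakk>x \<in> carrier G; y \<in> carrier G\<rbrakk> \<Longrightarrow> x \<otimes> y \<otimes> inv x \<otimes> inv y \<in> center G"
    and generator: "z \<in> carrier G" "center G = generate G {z}"
begin

lemma finite_subset_carrier: "S \<subseteq> carrier G \<Longrightarrow> finite S"
  using finite_carrier finite_subset by blast

text \<open>
  Adjoining \<open>x\<close> multiplies the order of \<open>B\<close> by at least the order \<open>r\<close> of \<open>x\<close> modulo \<open>B\<close>, and shrinks the
  centralizer by a factor of at most \<open>r\<close>: for \<open>y\<close> in the centralizer of \<open>B\<close>, the commutator \<open>[y, x]\<close>
  determines the coset of \<open>y\<close> modulo the smaller centralizer, and it satisfies
  \<open>[y, x]\<^sup>r = [y, x\<^sup>r] = \<one>\<close>, so that it takes at most \<open>r\<close> values in the cyclic center.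
\<close>
lemma card_centralizer_adjoin_le:
  assumes B: "subgroup B G" and x: "x \<in> carrier G"
  shows "card (centralizer G B) * card B
    \<le> card (centralizer G (insert x B)) * card (generate G (insert x B))"
proof -
  obtain r :: nat where r: "0 < r" "x [^] r \<in> B"
    and min: "\<And>k. \<lbrakk>k < r; x [^] k \<in> B\<rbrakk> \<Longrightarrow> k = 0"
    using least_power_in_subgroup[OF finite_carrier x B] by blast
  have BG: "B \<subseteq> carrier G" using B by (simp add: subgroup.subset)
  let ?B' = "generate G (insert x B)" and ?C = "centralizer G B"
    and ?C' = "centralizer G (insert x B)"
  have B': "subgroup ?B' G" using BG x by (simp add: generate_is_subgroup)
  have sub: "insert x B \<subseteq> ?B'" by (auto intro: generate.incl)

  have 1: "card B * r \<le> card ?B'"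
  proof -
    let ?f = "\<lambda>(b, i::nat). b \<otimes> x [^] i"
    \<comment> \<open>The cosets of \<open>B\<close> by the powers of \<open>x\<close> below \<open>r\<close> are disjoint, by minimality of \<open>r\<close>.\<close>
    have key: "i = j" if "b \<in> B" "b' \<in> B" "i \<le> j" "j < r" "b \<otimes> x [^] i = b' \<otimes> x [^] j"
      for b b' i j
    proof -
      have bG: "b \<in> carrier G" "b' \<in> carrier G" using that BG by auto
      have "x [^] j = x [^] (j - i) \<otimes> x [^] i" using x that(3) by (simp add: nat_pow_mult)
      then have "b \<otimes> x [^] i = b' \<otimes> x [^] (j - i) \<otimes> x [^] i"
        using that(5) x bG by (simp add: m_assoc)
      then have "b = b' \<otimes> x [^] (j - i)" using x bG by simp
      then have "x [^] (j - i) = inv b' \<otimes> b" using x bG by (simp add: inv_solve_left)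
      then have "x [^] (j - i) \<in> B"
        using that B by (simp add: subgroup.m_closed subgroup.m_inv_closed)
      then have "j - i = 0" by (rule min[rotated]) (use that in simp)
      then show ?thesis using that(3) by simp
    qed
    have "inj_on ?f (B \<times> {..<r})"
    proof (rule inj_onI, clarsimp)
      fix b i b' j assume *: "b \<in> B" "i < r" "b' \<in> B" "j < r" "b \<otimes> x [^] i = b' \<otimes> x [^] j"
      have "i = j" using key[of b b' i j] key[of b' b j i] * by (metis nat_le_linear)
      then show "b = b' \<and> i = j" using * x BG by (metis nat_pow_closed right_cancel subsetD)
    qed
    moreover have "?f ` (B \<times> {..<r}) \<subseteq> ?B'"
    proof -
      have "x [^] i \<in> ?B'" for i :: nat
        using sub B' subgroup_int_pow_closed[of ?B' x "int i"] by (simp add: int_pow_int)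
      then show ?thesis using sub B' by (auto intro!: subgroup.m_closed)
    qed
    ultimately have "card (B \<times> {..<r}) \<le> card ?B'"
      using finite_subset_carrier[OF subgroup.subset[OF B']] by (rule card_inj_on_le)
    then show ?thesis by (simp add: card_cartesian_product)
  qed

  have 2: "card ?C \<le> r * card ?C'"
  proof -
    let ?T = "{c \<in> center G. c [^] r = \<one>}"
    let ?F = "\<lambda>c. {y \<in> ?C. y \<otimes> x \<otimes> inv y \<otimes> inv x = c}"
    have finT: "finite ?T"
      by (rule finite_subset_carrier) (auto simp: center_def)
    have "y \<otimes> x \<otimes> inv y \<otimes> inv x \<in> ?T" if y: "y \<in> ?C" for y
    proof -
      have yG: "y \<in> carrier G" using y by (simp add: centralizer_def)
      define c where "c = y \<otimes> x \<otimes> inv y \<otimes> inv x"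
      have c: "c \<in> center G" unfolding c_def using commutator_central[OF yG x] .
      then have cG: "c \<in> carrier G" by (simp add: center_def)
      have yx: "y \<otimes> x = c \<otimes> (x \<otimes> y)" unfolding c_def by (rule commutator_swap[OF yG x])
      \<comment> \<open>Comparing \<open>x\<^sup>r y = y x\<^sup>r\<close> with the power law for the inverse commutator \<open>[x, y]\<close>.\<close>
      have ci: "inv c \<in> center G" using c by (simp add: subgroup_center subgroup.m_inv_closed)
      have "x \<otimes> y = inv c \<otimes> (y \<otimes> x)" using yx cG x yG by (simp add: inv_solve_left)
      then have "x [^] r \<otimes> y = inv c [^] r \<otimes> (y \<otimes> x [^] r)"
        using pow_commute_central[OF ci yG x] by blast
      moreover have "x [^] r \<otimes> y = y \<otimes> x [^] r" using y r(2) by (simp add: centralizer_def)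
      ultimately have "inv c [^] r = \<one>" using x yG cG by (simp add: r_cancel_one)
      then have "c [^] r = \<one>" using cG by (simp add: nat_pow_inv)
      then show ?thesis using c by (simp add: c_def)
    qed
    then have "?C = (\<Union>c\<in>?T. ?F c)" by blast
    then have "card ?C \<le> (\<Sum>c\<in>?T. card (?F c))" using card_UN_le[OF finT, of ?F] by simp
    also have "\<dots> \<le> (\<Sum>c\<in>?T. card ?C')"
    proof (rule sum_mono)
      fix c
      show "card (?F c) \<le> card ?C'"
      proof (cases "?F c = {}")
        case False
        then obtain w where w: "w \<in> ?F c" by blast
        have wG: "w \<in> carrier G" using w by (simp add: centralizer_def)
        \<comment> \<open>Elements with the same commutator conjugate \<open>x\<close> alike, so they lie in one coset.\<close>
        have "inv w \<otimes> y \<in> ?C'" if y: "y \<in> ?F c" for y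
        proof -
          have yG: "y \<in> carrier G" using y by (simp add: centralizer_def)
          have "inv w \<otimes> y \<in> ?C"
            using w y subgroup_centralizer[OF BG]
            by (simp add: subgroup.m_closed subgroup.m_inv_closed)
          moreover have "inv w \<otimes> y \<otimes> x = x \<otimes> (inv w \<otimes> y)"
          proof -
            have "w \<otimes> x \<otimes> inv w \<otimes> inv x = y \<otimes> x \<otimes> inv y \<otimes> inv x" using w y by simp
            then have e: "w \<otimes> x \<otimes> inv w = y \<otimes> x \<otimes> inv y" using wG yG x by simp
            have "inv w \<otimes> y \<otimes> x = inv w \<otimes> (y \<otimes> x \<otimes> inv y) \<otimes> y"
              using wG yG x by (simp add: m_assoc)
            also have "\<dots> = inv w \<otimes> (w \<otimes> x \<otimes> inv w) \<otimes> y" by (simp add: e)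
            also have "\<dots> = x \<otimes> (inv w \<otimes> y)"
              using wG yG x by (simp add: m_assoc[symmetric])
            finally show ?thesis .
          qed
          ultimately show ?thesis by (simp add: centralizer_def)
        qed
        then have "(\<lambda>y. inv w \<otimes> y) ` ?F c \<subseteq> ?C'" by blast
        moreover have "inj_on (\<lambda>y. inv w \<otimes> y) (?F c)"
          using wG by (auto simp: inj_on_def centralizer_def)
        ultimately show ?thesis
          using finite_subset_carrier[OF centralizer_subset] by (intro card_inj_on_le)
      next
        case True
        show ?thesis unfolding True by simp
      qed
    qed
    also have "\<dots> = card ?T * card ?C'" by simp
    also have "\<dots> \<le> r * card ?C'"
      using card_torsion_of_cyclic_le[OF finite_carrier generator(1) r(1)]
      by (simp add: generator(2))
    finally show ?thesis .
  qed
  have "card ?C * card B \<le> (r * card ?C') * card B" using 2 by (rule mult_right_mono) simp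
  also have "\<dots> = card ?C' * (card B * r)" by simp
  also have "\<dots> \<le> card ?C' * card ?B'" using 1 by (rule mult_left_mono) simp
  finally show ?thesis .
qed

lemma card_centralizer_mono:
  assumes "subgroup B G" "subgroup D G" "B \<subseteq> D"
  shows "card (centralizer G B) * card B \<le> card (centralizer G D) * card D"
  using assms
proof (induction "card D - card B" arbitrary: B rule: less_induct)
  case less
  show ?case
  proof (cases "B = D")
    case False
    then obtain x where x: "x \<in> D" "x \<notin> B" using less.prems by blast
    have DG: "D \<subseteq> carrier G" using less.prems by (simp add: subgroup.subset)
    let ?B' = "generate G (insert x B)"
    have sub: "insert x B \<subseteq> ?B'" by (auto intro: generate.incl)
    have B'D: "?B' \<subseteq> D" using x less.prems by (simp add: generate_subgroup_incl)
    have S: "insert x B \<subseteq> carrier G" using x DG less.prems by blast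
    have "B \<subset> ?B'" using sub x by blast
    moreover have "finite D" using DG by (rule finite_subset_carrier)
    ultimately have "card B < card ?B'" "card ?B' \<le> card D"
      using B'D by (auto intro: psubset_card_mono card_mono finite_subset)
    then have IH: "card (centralizer G ?B') * card ?B' \<le> card (centralizer G D) * card D"
      using S B'D less.prems by (intro less.hyps) (auto intro: generate_is_subgroup)
    have "card (centralizer G B) * card B \<le> card (centralizer G ?B') * card ?B'"
      using card_centralizer_adjoin_le[of B x] less.prems x DG S
      by (simp add: centralizer_generate subsetD)
    then show ?thesis using IH by (rule order_trans)
  qed simp
qed

text \<open>
  The product \<open>|C(B)| |B|\<close> grows with \<open>B\<close>, yet takes the same value at the two extremes \<open>B = Z\<close> and
  \<open>B = G\<close>. It is therefore constant in between.
\<close>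
lemma card_centralizer:
  assumes "subgroup B G" "center G \<subseteq> B"
  shows "card (centralizer G B) * card B = card (carrier G) * card (center G)"
proof (rule antisym)
  have top: "centralizer G (carrier G) = center G" by (simp add: center_eq_centralizer)
  have bot: "centralizer G (center G) = carrier G" by (auto simp: centralizer_def center_def)
  show "card (centralizer G B) * card B \<le> card (carrier G) * card (center G)"
    using card_centralizer_mono[OF assms(1) subgroup_self] assms(1)
    by (simp add: top subgroup.subset mult.commute)
  show "card (carrier G) * card (center G) \<le> card (centralizer G B) * card B"
    using card_centralizer_mono[OF subgroup_center assms] by (simp add: bot)
qed

text \<open>
  Adjoining the center keeps \<open>A\<close> abelian, so \<open>A\<close> may be assumed to contain it; its order is then at most
  that of its centralizer.
\<close>
lemma card_abelian_square_le:
  assumes "subgroup A G" "A \<subseteq> centralizer G A"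
  shows "card A * card A \<le> card (carrier G) * card (center G)"
proof -
  let ?B = "generate G (A \<union> center G)"
  have AG: "A \<subseteq> carrier G" using assms by (simp add: subgroup.subset)
  have "A \<union> center G \<subseteq> centralizer G (A \<union> center G)"
    using assms(2) AG by (auto simp: centralizer_def center_def)
  then have ab: "?B \<subseteq> centralizer G ?B" by (rule commuting_generators)
  have sub: "A \<union> center G \<subseteq> ?B" by (auto intro: generate.incl)
  have B: "subgroup ?B G"
    using AG subgroup.subset[OF subgroup_center] by (simp add: generate_is_subgroup)
  have fin: "finite ?B" "finite (centralizer G ?B)"
    using finite_subset_carrier[OF subgroup.subset[OF B]] finite_subset_carrier[OF centralizer_subset]
    by auto
  have "card A \<le> card ?B" "card ?B \<le> card (centralizer G ?B)"
    using sub ab fin by (auto intro: card_mono)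
  then have "card A * card A \<le> card (centralizer G ?B) * card ?B" by (intro mult_mono) auto
  also have "\<dots> = card (carrier G) * card (center G)" using B sub by (intro card_centralizer) auto
  finally show ?thesis .
qed

lemma order_generator: "ord z = card (center G)"
  using generate_pow_card generator by simp

lemma pow_card_center:
  assumes "c \<in> center G"
  shows "c [^] card (center G) = \<one>"
proof -
  obtain i :: int where "c = z [^] i" using assms generator generate_pow by auto
  then have "c [^] card (center G) = (z [^] card (center G)) [^] i"
    using generator(1) by (simp add: int_pow_pow mult.commute flip: int_pow_int)
  then show ?thesis using generator(1) pow_ord_eq_1[of z] by (simp add: order_generator)
qed

text \<open>If \<open>n\<close> is the order of the center, then \<open>[x\<^sup>n, y] = [x, y]\<^sup>n = \<one>\<close>.\<close>
lemma pow_card_center_central: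
  assumes "x \<in> carrier G"
  shows "x [^] card (center G) \<in> center G"
proof -
  let ?n = "card (center G)"
  have "x [^] ?n \<otimes> y = y \<otimes> x [^] ?n" if y: "y \<in> carrier G" for y
  proof -
    define c where "c = x \<otimes> y \<otimes> inv x \<otimes> inv y"
    have c: "c \<in> center G" unfolding c_def using commutator_central[OF assms y] .
    then have cG: "c \<in> carrier G" by (simp add: center_def)
    have "x \<otimes> y = c \<otimes> (y \<otimes> x)" unfolding c_def by (rule commutator_swap[OF assms y])
    then have "x [^] ?n \<otimes> y = c [^] ?n \<otimes> (y \<otimes> x [^] ?n)"
      by (rule pow_commute_central[OF c y assms])
    moreover have "c [^] ?n = \<one>" using c by (rule pow_card_center)
    ultimately show ?thesis using assms y by simp
  qed
  then show ?thesis using assms by (simp add: center_def)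
qed

text \<open>
  Oddness makes \<open>n choose 2\<close> a multiple of \<open>n\<close>, which kills the commutator factor in \<open>(x y)\<^sup>n\<close>.
\<close>
lemma pow_card_center_mult:
  assumes odd: "odd (card (center G))" and x: "x \<in> carrier G" and y: "y \<in> carrier G"
  shows "(x \<otimes> y) [^] card (center G) = x [^] card (center G) \<otimes> y [^] card (center G)"
proof -
  let ?n = "card (center G)"
  define c where "c = y \<otimes> x \<otimes> inv y \<otimes> inv x"
  have c: "c \<in> center G" unfolding c_def using commutator_central[OF y x] .
  then have cG: "c \<in> carrier G" by (simp add: center_def)
  have yx: "y \<otimes> x = c \<otimes> (x \<otimes> y)" unfolding c_def by (rule commutator_swap[OF y x])
  have "even (?n - 1)" using odd by simp
  then have "?n choose 2 = ?n * ((?n - 1) div 2)" by (simp add: choose_two div_mult_swap)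
  then have "c [^] (?n choose 2) = \<one>"
    using cG pow_card_center[OF c] by (simp flip: nat_pow_pow)
  then show ?thesis using mult_pow_central[OF c x y yx, of ?n] x y by simp
qed

lemma subgroup_pow_card_center_kernel:
  assumes odd: "odd (card (center G))"
  shows "subgroup {x \<in> carrier G. x [^] card (center G) = \<one>} G" (is "subgroup ?K G")
proof (rule subgroupI)
  have "\<one> \<in> ?K" by simp
  then show "?K \<noteq> {}" by blast
qed (auto simp: nat_pow_inv pow_card_center_mult[OF odd])

text \<open>
  Maximality is imposed only among abelian subgroups of the kernel \<open>K\<close> of the power map, which secures
  the exponent. That \<open>H\<close> is nevertheless as large as any abelian subgroup of \<open>G\<close> follows from
  \<open>C(H)\<close> being abelian, the center being cyclic.
\<close>
theorem ex_self_centralizing_subgroup: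
  assumes odd: "odd (card (center G))"
  obtains H where "subgroup H G" "center G \<subseteq> H" "H \<subseteq> centralizer G H"
    "\<And>x. x \<in> H \<Longrightarrow> x [^] card (center G) = \<one>"
    "card H * card H = card (carrier G) * card (center G)"
proof -
  let ?n = "card (center G)"
  define K where "K = {x \<in> carrier G. x [^] ?n = \<one>}"
  have K: "subgroup K G" unfolding K_def by (rule subgroup_pow_card_center_kernel[OF odd])
  define F where "F = {B. subgroup B G \<and> center G \<subseteq> B \<and> B \<subseteq> K \<and> B \<subseteq> centralizer G B}"
  have ZG: "center G \<subseteq> carrier G" by (auto simp: center_def)
  then have "center G \<subseteq> K" using pow_card_center by (auto simp: K_def)
  then have "center G \<in> F"
    by (simp add: F_def subgroup_center center_subset_centralizer[OF ZG])
  moreover have "F \<subseteq> Pow (carrier G)" unfolding F_def using subgroup.subset by blast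
  then have "finite F" using finite_carrier finite_subset by blast
  ultimately obtain H where H: "H \<in> F" and max: "\<And>B. B \<in> F \<Longrightarrow> H \<subseteq> B \<Longrightarrow> H = B"
    using finite_has_maximal[of F] by (metis empty_iff)
  have HF: "subgroup H G" "center G \<subseteq> H" "H \<subseteq> K" "H \<subseteq> centralizer G H"
    using H by (simp_all add: F_def)
  have HG: "H \<subseteq> carrier G" using HF(1) by (simp add: subgroup.subset)
  let ?C = "centralizer G H"
  have C: "subgroup ?C G" using HG by (rule subgroup_centralizer)
  have adjoin: "insert y H \<subseteq> centralizer G (insert y H)" if "y \<in> ?C" for y
    using that HF(4) by (auto simp: centralizer_def)

  have CK: "y \<in> H" if y: "y \<in> ?C" "y \<in> K" for y
  proof -
    let ?B = "generate G (insert y H)"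
    have yG: "y \<in> carrier G" using y(1) by (simp add: centralizer_def)
    have sub: "insert y H \<subseteq> ?B" by (auto intro: generate.incl)
    have "subgroup ?B G" using yG HG by (simp add: generate_is_subgroup)
    moreover have "center G \<subseteq> ?B" using HF(2) sub by blast
    moreover have "?B \<subseteq> K" using HF(3) y(2) by (simp add: generate_subgroup_incl[OF _ K])
    moreover have "?B \<subseteq> centralizer G ?B" by (rule commuting_generators[OF adjoin[OF y(1)]])
    ultimately have "?B \<in> F" by (simp add: F_def)
    then have "H = ?B" using max sub by blast
    then show ?thesis using sub by blast
  qed

  \<comment> \<open>The power map sends \<open>C(H)\<close> onto a cyclic group with kernel \<open>H\<close>, so one preimage \<open>x\<close> of a generator
    together with \<open>H\<close> generates \<open>C(H)\<close>.\<close>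
  let ?T = "(\<lambda>y. y [^] ?n) ` ?C"
  have "subgroup ?T G"
  proof (rule subgroupI)
    show "?T \<subseteq> carrier G" by (auto simp: centralizer_def)
    show "?T \<noteq> {}" using subgroup.one_closed[OF C] by blast
    fix a assume "a \<in> ?T"
    then obtain u where u: "u \<in> ?C" "a = u [^] ?n" by blast
    then show "inv a \<in> ?T"
      using C subgroup.m_inv_closed[OF C u(1)] subgroup.mem_carrier[OF C u(1)]
      by (auto simp: nat_pow_inv intro!: image_eqI[of _ _ "inv u"])
    fix b assume "b \<in> ?T"
    then obtain v where v: "v \<in> ?C" "b = v [^] ?n" by blast
    show "a \<otimes> b \<in> ?T"
      using u v subgroup.m_closed[OF C u(1) v(1)] subgroup.mem_carrier[OF C]
      by (auto simp: pow_card_center_mult[OF odd] intro!: image_eqI[of _ _ "u \<otimes> v"])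
  qed
  moreover have "?T \<subseteq> generate G {z}"
    using pow_card_center_central by (auto simp: centralizer_def generator(2)[symmetric])
  ultimately obtain t where t: "t \<in> ?T" "?T = generate G {t}"
    by (rule subgroup_of_cyclic[OF finite_carrier generator(1)])
  obtain x where x: "x \<in> ?C" "t = x [^] ?n" using t(1) by blast
  have xG: "x \<in> carrier G" using x(1) by (simp add: centralizer_def)

  let ?D = "generate G (insert x H)"
  have sub: "insert x H \<subseteq> ?D" by (auto intro: generate.incl)
  have D: "subgroup ?D G" using xG HG by (simp add: generate_is_subgroup)
  have "?C \<subseteq> ?D"
  proof
    fix y assume y: "y \<in> ?C"
    have yG: "y \<in> carrier G" using y by (simp add: centralizer_def)
    have "y [^] ?n \<in> generate G {t}" using y t(2) by blast
    then obtain i :: int where i: "y [^] ?n = (x [^] ?n) [^] i"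
      using x(2) xG generate_pow[of t] by auto
    define w where "w = x [^] i"
    have wC: "w \<in> ?C" unfolding w_def by (rule subgroup_int_pow_closed[OF C x(1)])
    have wG: "w \<in> carrier G" using xG by (simp add: w_def)
    have "y [^] ?n = w [^] ?n"
      using i xG by (simp add: w_def int_pow_pow mult.commute flip: int_pow_int)
    then have "(y \<otimes> inv w) [^] ?n = \<one>"
      using yG wG by (simp add: pow_card_center_mult[OF odd] nat_pow_inv)
    then have "y \<otimes> inv w \<in> H"
      using CK y wC C yG wG by (simp add: K_def subgroup.m_closed subgroup.m_inv_closed)
    then have "y \<otimes> inv w \<in> ?D" using sub by blast
    moreover have "w \<in> ?D"
      unfolding w_def by (rule subgroup_int_pow_closed[OF D]) (use sub in blast)
    ultimately have "y \<otimes> inv w \<otimes> w \<in> ?D" by (rule subgroup.m_closed[OF D])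
    then show "y \<in> ?D" using yG wG by (simp add: m_assoc)
  qed
  moreover have "?D \<subseteq> centralizer G ?D" by (rule commuting_generators[OF adjoin[OF x(1)]])
  ultimately have "?C \<subseteq> centralizer G ?C" using centralizer_antimono by blast
  then have "card ?C * card ?C \<le> card ?C * card H"
    using card_abelian_square_le[OF C] card_centralizer[OF HF(1,2)] by simp
  moreover have "0 < card ?C"
    using subgroup.one_closed[OF C] finite_subset_carrier[OF centralizer_subset]
    by (auto simp: card_gt_0_iff)
  ultimately have "card ?C \<le> card H" by simp
  moreover have "card H \<le> card ?C"
    using HF(4) finite_subset_carrier[OF centralizer_subset] by (rule card_mono[rotated])
  ultimately have "card H * card H = card (carrier G) * card (center G)"
    using card_centralizer[OF HF(1,2)] by simp
  moreover have "x [^] ?n = \<one>" if "x \<in> H" for x using that HF(3) by (auto simp: K_def)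
  ultimately show thesis using HF(1,2,4) that by blast
qed

end

section \<open>Abelian normal subgroups of maximum order\<close>

lemma (in group) comm_group_subgroup_iff:
  assumes "subgroup H G"
  shows "comm_group (G\<lparr>carrier := H\<rparr>) \<longleftrightarrow> H \<subseteq> centralizer G H"
proof
  assume "comm_group (G\<lparr>carrier := H\<rparr>)"
  then interpret H: comm_group "G\<lparr>carrier := H\<rparr>" .
  show "H \<subseteq> centralizer G H"
    using H.m_comm assms by (auto simp: centralizer_def subgroup.mem_carrier)
next
  assume "H \<subseteq> centralizer G H"
  then show "comm_group (G\<lparr>carrier := H\<rparr>)"
    using subgroup_imp_group[OF assms]
    by (intro group.group_comm_groupI) (auto simp: centralizer_def)
qed

text \<open>
  The term of index \<open>2\<close> of the lower central series contains all \<open>[[x, y], g]\<close>, so its triviality says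
  that \<open>[x, y]\<close> commutes with every \<open>g\<close>.
\<close>
lemma (in group) class_two_commutator_central:
  assumes "has_nilpotency_class G 2" and x: "x \<in> carrier G" and y: "y \<in> carrier G"
  shows "x \<otimes> y \<otimes> inv x \<otimes> inv y \<in> center G"
proof -
  define c where "c = x \<otimes> y \<otimes> inv x \<otimes> inv y"
  have cG: "c \<in> carrier G" using x y by (simp add: c_def)
  have "c \<in> lower_central_series G 1"
    using x y by (auto simp: c_def commutator_subgroup_def intro!: generate.incl)
  then have "c \<otimes> g \<otimes> inv c \<otimes> inv g \<in> lower_central_series G 2" if "g \<in> carrier G" for g
    using that by (auto simp: numeral_2_eq_2 commutator_subgroup_def intro!: generate.incl)
  then have "c \<otimes> g \<otimes> inv c \<otimes> inv g = \<one>" if "g \<in> carrier G" for g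
    using that assms(1) by (simp add: has_nilpotency_class_def)
  then have "c \<otimes> g = g \<otimes> c" if "g \<in> carrier G" for g
    using that cG by (metis inv_solve_right' inv_closed l_one m_closed)
  then show ?thesis using cG by (simp add: center_def c_def)
qed

theorem proposition24:
  fixes G :: "('a, 'b) monoid_scheme" and p :: nat
  assumes "prime p" and "p \<ge> 3"
    and "finite_p_group p G"
    and "has_nilpotency_class G 2"
    and "cyclic_group (G\<lparr>carrier := center G\<rparr>)"
  shows "\<exists>H. abelian_normal_subgroup H G
    \<and> (\<forall>K. abelian_normal_subgroup K G \<longrightarrow> card K \<le> card H)
    \<and> exponent (G\<lparr>carrier := H\<rparr>) = card (center G)"
proof -
  interpret group G using assms(3) by (simp add: finite_p_group_def)
  obtain n where n: "order G = p ^ n" using assms(3) by (auto simp: finite_p_group_def)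
  have p: "0 < p" "odd p" using assms(1,2) prime_odd_nat by auto
  have fin: "finite (carrier G)" using n p by (simp flip: order_gt_0_iff_finite)
  have oddZ: "odd (card (center G))"
  proof -
    have "card (center G) dvd p ^ n" using lagrange[OF subgroup_center] n by (metis dvd_triv_right)
    moreover have "odd (p ^ n)" using p by simp
    ultimately show ?thesis using dvd_trans by blast
  qed
  interpret Z: group "G\<lparr>carrier := center G\<rparr>" by (rule subgroup_imp_group[OF subgroup_center])
  obtain z where z: "z \<in> center G"
    and zc: "center G = range (\<lambda>n::int. z [^]\<^bsub>G\<lparr>carrier := center G\<rparr>\<^esub> n)"
    using assms(5) by (auto simp: Z.cyclic_group)
  have zG: "z \<in> carrier G" using z by (simp add: center_def)
  have "center G = generate G {z}"
    using zc int_pow_consistent[OF subgroup_center z] zG by (auto simp: generate_pow)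
  then interpret class2_cyclic_center G z
    using fin zG class_two_commutator_central[OF assms(4)] by unfold_locales auto
  obtain H where H: "subgroup H G" "center G \<subseteq> H" "H \<subseteq> centralizer G H"
    "\<And>x. x \<in> H \<Longrightarrow> x [^]\<^bsub>G\<^esub> card (center G) = \<one>\<^bsub>G\<^esub>"
    "card H * card H = card (carrier G) * card (center G)"
    by (rule ex_self_centralizing_subgroup[OF oddZ]) (rule that)
  have "abelian_normal_subgroup H G"
    using H normal_of_center_subset[OF commutator_central]
    by (simp add: abelian_normal_subgroup_def comm_group_subgroup_iff)
  moreover have "card K \<le> card H" if "abelian_normal_subgroup K G" for K
  proof -
    have K: "subgroup K G" using that by (simp add: abelian_normal_subgroup_def normal_imp_subgroup)
    then have "K \<subseteq> centralizer G K"
      using that by (simp add: abelian_normal_subgroup_def comm_group_subgroup_iff)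
    then have "card K * card K \<le> card H * card H" using card_abelian_square_le[OF K] H(5) by simp
    then show ?thesis by (metis mult_strict_mono' not_le zero_le)
  qed
  moreover have "exponent (G\<lparr>carrier := H\<rparr>) = card (center G)"
    unfolding exponent_def
  proof (rule Least_equality)
    have pow: "x [^]\<^bsub>G\<lparr>carrier := H\<rparr>\<^esub> m = x [^]\<^bsub>G\<^esub> m" for x and m :: nat
      by (simp flip: nat_pow_consistent)
    show "0 < card (center G) \<and> (\<forall>x\<in>carrier (G\<lparr>carrier := H\<rparr>).
      x [^]\<^bsub>G\<lparr>carrier := H\<rparr>\<^esub> card (center G) = \<one>\<^bsub>G\<lparr>carrier := H\<rparr>\<^esub>)"
      using H(4) oddZ odd_pos by (simp add: pow)
    fix m :: nat assume "0 < m \<and> (\<forall>x\<in>carrier (G\<lparr>carrier := H\<rparr>).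
      x [^]\<^bsub>G\<lparr>carrier := H\<rparr>\<^esub> m = \<one>\<^bsub>G\<lparr>carrier := H\<rparr>\<^esub>)"
    then have m: "0 < m" "z [^]\<^bsub>G\<^esub> m = \<one>\<^bsub>G\<^esub>" using z H(2) by (auto simp: pow)
    then show "card (center G) \<le> m"
      using zG by (simp add: pow_eq_id dvd_imp_le flip: order_generator)
  qed
  ultimately show ?thesis by blast
qed

end
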